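(* Let $\mathfrak g$ be a graded Lie algebra as in the context. Then: (a) $U^!(\mathfrak g)$ is an algebra. (b) Moreover, if $a,b>0$, $z\in U^!_a(\mathfrak g)$ and $u\in U^!_b(\mathfrak g)$, then $zu\in U^!_{a+b}(\mathfrak g)$ and $$[[zu]]_{a+b}\le[[z]]_a\cdot[[u]]_b.$$ (c) $U^!(\mathfrak g)$ does not depend on the choice of the basis in $\mathfrak g^{[1]}$.
   Context: $\mathfrak g=\bigoplus_{k>0}\mathfrak g^{[k]}$ is a graded real Lie algebra ($[\mathfrak g^{[k]},\mathfrak g^{[m]}]\subset\mathfrak g^{[k+m]}$), with $\dim\mathfrak g^{[k]}<\infty$, generated by $\mathfrak g^{[1]}$; $\omega_1,\dots,\omega_n$ is a basis of $\mathfrak g^{[1]}$. The universal enveloping algebra $U(\mathfrak g)=\bigoplus_{p\ge0}U(\mathfrak g)^{[p]}$ has the induced grading; $\overline U(\mathfrak g)=\prod_{p\ge 0}U(\mathfrak g)^{[p]}$ is the algebra of formal series $z=\sum_p z^{[p]}$. For $z\in U(\mathfrak g)^{[p]}$ the norm is $\|z\|=\inf\sum_w|c_w|$, the infimum over all representations $z=\sum_w c_w w$ as a finite linear combination of words $w=\omega_{j_1}\cdots\omega_{j_p}$. For $a>0$ and $z\in\overline U(\mathfrak g)$ put $[[z]]_a=\sup_p\|z^{[p]}\|\cdot p!\,a^{-p}$; $U^!_a(\mathfrak g)=\{z\in\overline U(\mathfrak g):[[z]]_a<\infty\}$ and $U^!(\mathfrak g)=\bigcup_{a>0}U^!_a(\mathfrak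 g)$. *)

theory Defs
  imports
    Complex_Main
    "HOL-Library.Poly_Mapping"
    "HOL-Library.Extended_Real"
    "HOL-Computational_Algebra.Formal_Power_Series"
begin

section \<open>Real Lie algebras and gradings\<close>

class lie_algebra = real_vector +
  fixes bracket :: "'a \<Rightarrow> 'a \<Rightarrow> 'a"
  assumes bracket_add_left: "bracket (x + y) z = bracket x z + bracket y z"
    and bracket_add_right: "bracket x (y + z) = bracket x y + bracket x z"
    and bracket_scaleR_left: "bracket (r *\<^sub>R x) y = r *\<^sub>R bracket x y"
    and bracket_scaleR_right: "bracket x (r *\<^sub>R y) = r *\<^sub>R bracket x y"
    and bracket_self: "bracket x x = 0"
    and jacobi: "bracket x (bracket y z) + bracket y (bracket z x) + bracket z (bracket x y) = 0"

definition lie_subalgebra :: "'g::lie_algebra set \<Rightarrow> bool" where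
  "lie_subalgebra S \<longleftrightarrow> subspace S \<and> (\<forall>x\<in>S. \<forall>y\<in>S. bracket x y \<in> S)"

text \<open>
  The index set of the grading is \<^typ>\<open>nat\<close>; that only degrees \<open>k > 0\<close> occur is expressed by
  \<open>grade_0\<close>.
\<close>

locale graded_lie_algebra =
  fixes G :: "nat \<Rightarrow> 'g::lie_algebra set"
  assumes grade_subspace: "subspace (G k)"
    and grade_0: "G 0 = {0}"
    and grade_direct_sum:
      "\<exists>!f. (\<forall>k. f k \<in> G k) \<and> finite {k. f k \<noteq> 0} \<and> x = (\<Sum>k | f k \<noteq> 0. f k)"
    and grade_bracket: "x \<in> G k \<Longrightarrow> y \<in> G m \<Longrightarrow> bracket x y \<in> G (k + m)"
    and grade_finite_dim: "\<exists>B. finite B \<and> span B = G k"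
    and grade_generated: "lie_subalgebra hull (G 1) = UNIV"

text \<open>\<open>\<omega> 1, \<dots>, \<omega> n\<close> is a basis of the subspace \<open>V\<close>; values of \<open>\<omega>\<close> at other indices are irrelevant.\<close>

definition is_basis :: "nat \<Rightarrow> (nat \<Rightarrow> 'g::real_vector) \<Rightarrow> 'g set \<Rightarrow> bool" where
  "is_basis n \<omega> V \<longleftrightarrow>
     inj_on \<omega> {1..n} \<and> independent (\<omega> ` {1..n}) \<and> span (\<omega> ` {1..n}) = V"

section \<open>The universal enveloping algebra\<close>

text \<open>
  The free monoid on a set, written additively, so that \<open>'a free_mon \<Rightarrow>\<^sub>0 real\<close> with the
  convolution product of \<^theory>\<open>HOL-Library.Poly_Mapping\<close> is the free associative unital real
  algebra on \<^typ>\<open>'a\<close>.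
\<close>

datatype 'a free_mon = FM (letters: "'a list")

instantiation free_mon :: (type) monoid_add
begin

definition zero_free_mon :: "'a free_mon" where "0 = FM []"
definition plus_free_mon :: "'a free_mon \<Rightarrow> 'a free_mon \<Rightarrow> 'a free_mon" where
  "v + w = FM (letters v @ letters w)"

instance
  by standard (auto simp: zero_free_mon_def plus_free_mon_def)

end

definition free_gen :: "'a \<Rightarrow> ('a free_mon \<Rightarrow>\<^sub>0 real)" where
  "free_gen x = Poly_Mapping.single (FM [x]) 1"

definition free_scale :: "real \<Rightarrow> ('a free_mon \<Rightarrow>\<^sub>0 real) \<Rightarrow> ('a free_mon \<Rightarrow>\<^sub>0 real)" where
  "free_scale c a = Poly_Mapping.single 0 c * a"

text \<open>
  The two-sided ideal defining \<open>U(\<gg>)\<close>.  The rules \<open>lin_add\<close> and \<open>lin_scale\<close> turn the free algebra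
  on the set \<open>\<gg>\<close> into the tensor algebra of the vector space \<open>\<gg>\<close>; the rule \<open>comm\<close> imposes
  \<open>xy - yx = [x, y]\<close>.  Closure under scalars is a special case of \<open>mult_left\<close>.
\<close>

inductive_set uea_ideal :: "('g::lie_algebra free_mon \<Rightarrow>\<^sub>0 real) set" where
  zero: "0 \<in> uea_ideal"
| lin_add: "free_gen (x + y) - free_gen x - free_gen y \<in> uea_ideal"
| lin_scale: "free_gen (r *\<^sub>R x) - free_scale r (free_gen x) \<in> uea_ideal"
| comm: "free_gen x * free_gen y - free_gen y * free_gen x - free_gen (bracket x y) \<in> uea_ideal"
| add: "a \<in> uea_ideal \<Longrightarrow> b \<in> uea_ideal \<Longrightarrow> a + b \<in> uea_ideal"
| mult_left: "a \<in> uea_ideal \<Longrightarrow> c * a \<in> uea_ideal"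
| mult_right: "a \<in> uea_ideal \<Longrightarrow> a * c \<in> uea_ideal"

definition uea_rel :: "('g::lie_algebra free_mon \<Rightarrow>\<^sub>0 real) \<Rightarrow> ('g free_mon \<Rightarrow>\<^sub>0 real) \<Rightarrow> bool" where
  "uea_rel a b \<longleftrightarrow> a - b \<in> uea_ideal"

lemma uea_ideal_uminus: "a \<in> uea_ideal \<Longrightarrow> - a \<in> uea_ideal"
  using uea_ideal.mult_left[of a "-1"] by simp

lemma uea_ideal_diff: "a \<in> uea_ideal \<Longrightarrow> b \<in> uea_ideal \<Longrightarrow> a - b \<in> uea_ideal"
  using uea_ideal.add[OF _ uea_ideal_uminus, of a b] by simp

lemma equivp_uea_rel:
  "equivp (uea_rel :: ('g::lie_algebra free_mon \<Rightarrow>\<^sub>0 real) \<Rightarrow> _)" (is "equivp ?R")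
proof (rule equivpI)
  show "reflp ?R"
    by (simp add: reflp_def uea_rel_def uea_ideal.zero)
  show "symp ?R"
    unfolding symp_def uea_rel_def by (metis minus_diff_eq uea_ideal_uminus)
  show "transp ?R"
  proof (rule transpI)
    fix a b c :: "'g free_mon \<Rightarrow>\<^sub>0 real"
    assume "uea_rel a b" "uea_rel b c"
    then have "(a - b) + (b - c) \<in> uea_ideal"
      unfolding uea_rel_def by (rule uea_ideal.add)
    then show "uea_rel a c" by (simp add: uea_rel_def)
  qed
qed

quotient_type (overloaded) 'g uea = "'g::lie_algebra free_mon \<Rightarrow>\<^sub>0 real" / uea_rel
  by (rule equivp_uea_rel)

lemma poly_mapping_single_induct:
  fixes a :: "'a \<Rightarrow>\<^sub>0 'b::ab_group_add"
  assumes "P 0" "\<And>k v. P (Poly_Mapping.single k v)" "\<And>a b. P a \<Longrightarrow> P b \<Longrightarrow> P (a + b)"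
  shows "P a"
proof -
  have sum: "P (\<Sum>k\<in>K. Poly_Mapping.single k (Poly_Mapping.lookup a k))" if "finite K" for K
    using that by induction (auto intro: assms)
  have "a = (\<Sum>k\<in>Poly_Mapping.keys a. Poly_Mapping.single k (Poly_Mapping.lookup a k))"
    by (rule poly_mapping_eqI) (auto simp: lookup_sum lookup_single when_def in_keys_iff)
  with sum[OF finite_keys] show ?thesis by metis
qed

lemma free_scale_comm: "a * free_scale c b = free_scale c (a * b)"
proof -
  have "a * Poly_Mapping.single 0 c = Poly_Mapping.single 0 c * a"
    by (induction a rule: poly_mapping_single_induct) (auto simp: mult_single algebra_simps)
  then show ?thesis unfolding free_scale_def by (metis mult.assoc)
qed

text \<open>The augmentation (coefficient of the empty word) shows that \<open>U(\<gg>)\<close> is not the zero ring.\<close>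

lemma free_lookup_mult_0:
  "Poly_Mapping.lookup (a * b) 0 = Poly_Mapping.lookup a 0 * Poly_Mapping.lookup b 0"
  for a b :: "'a free_mon \<Rightarrow>\<^sub>0 real"
proof (induction a rule: poly_mapping_single_induct)
  case (2 k v)
  show ?case
  proof (induction b rule: poly_mapping_single_induct)
    case (2 l w)
    have "k + l = 0 \<longleftrightarrow> k = 0 \<and> l = 0"
      by (cases k; cases l) (auto simp: zero_free_mon_def plus_free_mon_def)
    then show ?case by (auto simp: mult_single lookup_single when_def)
  qed (auto simp: lookup_add algebra_simps)
qed (auto simp: lookup_add algebra_simps)

lemma free_gen_lookup_0: "Poly_Mapping.lookup (free_gen x) 0 = 0"
  by (simp add: free_gen_def lookup_single when_def zero_free_mon_def)

lemma uea_ideal_lookup_0: "a \<in> uea_ideal \<Longrightarrow> Poly_Mapping.lookup a 0 = 0"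
  by (induction rule: uea_ideal.induct)
    (auto simp: lookup_minus lookup_add free_lookup_mult_0 free_scale_def free_gen_lookup_0)

instantiation uea :: (lie_algebra) real_algebra_1
begin

lift_definition zero_uea :: "'a uea" is 0 .
lift_definition one_uea :: "'a uea" is 1 .
lift_definition plus_uea :: "'a uea \<Rightarrow> 'a uea \<Rightarrow> 'a uea" is "(+)"
  unfolding uea_rel_def by (simp add: add_diff_add uea_ideal.add)
lift_definition minus_uea :: "'a uea \<Rightarrow> 'a uea \<Rightarrow> 'a uea" is "(-)"
proof -
  fix a b c d :: "'a free_mon \<Rightarrow>\<^sub>0 real"
  assume "uea_rel a b" "uea_rel c d"
  then have "(a - b) - (c - d) \<in> uea_ideal"
    unfolding uea_rel_def by (rule uea_ideal_diff)
  then show "uea_rel (a - c) (b - d)"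
    unfolding uea_rel_def by (simp add: algebra_simps)
qed
lift_definition uminus_uea :: "'a uea \<Rightarrow> 'a uea" is uminus
  unfolding uea_rel_def by (simp only: minus_diff_minus uea_ideal_uminus)
lift_definition times_uea :: "'a uea \<Rightarrow> 'a uea \<Rightarrow> 'a uea" is "(*)"
proof -
  fix a b c d :: "'a free_mon \<Rightarrow>\<^sub>0 real"
  assume "uea_rel a b" "uea_rel c d"
  then have "(a - b) * c + b * (c - d) \<in> uea_ideal"
    unfolding uea_rel_def by (intro uea_ideal.add uea_ideal.mult_left uea_ideal.mult_right)
  then show "uea_rel (a * c) (b * d)"
    unfolding uea_rel_def by (simp add: algebra_simps)
qed
lift_definition scaleR_uea :: "real \<Rightarrow> 'a uea \<Rightarrow> 'a uea" is free_scale
  unfolding uea_rel_def free_scale_def by (simp only: uea_ideal.mult_left flip: right_diff_distrib)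

instance
proof
  have rel: "uea_rel a b" if "a = b" for a b :: "'a free_mon \<Rightarrow>\<^sub>0 real"
    using that by (simp add: uea_rel_def uea_ideal.zero)
  fix a b c :: "'a uea" and r s :: real
  show "a + b + c = a + (b + c)" by transfer (rule rel, simp add: algebra_simps)
  show "a + b = b + a" by transfer (rule rel, simp add: algebra_simps)
  show "0 + a = a" by transfer (rule rel, simp)
  show "- a + a = 0" by transfer (rule rel, simp)
  show "a - b = a + - b" by transfer (rule rel, simp)
  show "a * b * c = a * (b * c)" by transfer (rule rel, simp add: mult.assoc)
  show "1 * a = a" by transfer (rule rel, simp)
  show "a * 1 = a" by transfer (rule rel, simp)
  show "(a + b) * c = a * c + b * c" by transfer (rule rel, simp add: algebra_simps)
  show "a * (b + c) = a * b + a * c" by transfer (rule rel, simp add: algebra_simps)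
  show "r *\<^sub>R (a + b) = r *\<^sub>R a + r *\<^sub>R b"
    by transfer (rule rel, simp add: free_scale_def algebra_simps)
  show "(r + s) *\<^sub>R a = r *\<^sub>R a + s *\<^sub>R a"
    by transfer (rule rel, simp add: free_scale_def single_add algebra_simps)
  show "r *\<^sub>R s *\<^sub>R a = (r * s) *\<^sub>R a"
    by transfer (rule rel, simp add: free_scale_def mult_single flip: mult.assoc)
  show "1 *\<^sub>R a = a" by transfer (rule rel, simp add: free_scale_def)
  show "r *\<^sub>R a * b = r *\<^sub>R (a * b)"
    by transfer (rule rel, simp add: free_scale_def mult.assoc)
  show "a * r *\<^sub>R b = r *\<^sub>R (a * b)"
    by transfer (rule rel, simp add: free_scale_comm)
  show "(0 :: 'a uea) \<noteq> 1"
    by transfer (auto simp: uea_rel_def lookup_minus dest: uea_ideal_lookup_0)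
qed

end

lift_definition uea_emb :: "'g::lie_algebra \<Rightarrow> 'g uea" is free_gen .

definition uea_prod :: "'g::lie_algebra list \<Rightarrow> 'g uea" where
  "uea_prod xs = prod_list (map uea_emb xs)"

text \<open>
  The induced grading: \<open>U(\<gg>)\<^bsup>[p]\<^esup>\<close> is spanned by the products \<open>x\<^sub>1 \<dots> x\<^sub>m\<close> (\<open>m \<ge> 0\<close>) of homogeneous
  elements of \<open>\<gg>\<close> with total degree \<open>p\<close>.
\<close>

definition uea_grade :: "(nat \<Rightarrow> 'g::lie_algebra set) \<Rightarrow> nat \<Rightarrow> 'g uea set" where
  "uea_grade G p =
     span {uea_prod xs |xs ks. list_all2 (\<lambda>x k. x \<in> G k) xs ks \<and> sum_list ks = p}"

section \<open>Formal series\<close>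

text \<open>
  A formal series \<open>\<Sum>\<^sub>p z\<^bsup>[p]\<^esup>\<close> is represented by the power series over \<open>U(\<gg>)\<close> whose \<open>p\<close>-th coefficient
  is \<open>z\<^bsup>[p]\<^esup>\<close>; the formal variable only records the degree, and the product
  \<open>(zu)\<^bsup>[p]\<^esup> = \<Sum>\<^bsub>i + j = p\<^esub> z\<^bsup>[i]\<^esup> u\<^bsup>[j]\<^esup>\<close> is that of power series.
\<close>

instantiation fps :: (real_algebra_1) real_algebra_1
begin

definition scaleR_fps :: "real \<Rightarrow> 'a fps \<Rightarrow> 'a fps" where
  "scaleR_fps c f = Abs_fps (\<lambda>n. c *\<^sub>R fps_nth f n)"

instance
  by standard
    (auto simp: scaleR_fps_def fps_eq_iff fps_mult_nth algebra_simps scaleR_sum_right)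

end

definition uea_series :: "(nat \<Rightarrow> 'g::lie_algebra set) \<Rightarrow> 'g uea fps set" where
  "uea_series G = {z. \<forall>p. fps_nth z p \<in> uea_grade G p}"

definition unital_subalgebra :: "'a::real_algebra_1 set \<Rightarrow> bool" where
  "unital_subalgebra S \<longleftrightarrow> subspace S \<and> 1 \<in> S \<and> (\<forall>x\<in>S. \<forall>y\<in>S. x * y \<in> S)"

lemma uea_grade_1: "1 \<in> uea_grade G 0"
proof -
  have "uea_prod [] = 1" by (simp add: uea_prod_def)
  then show ?thesis
    unfolding uea_grade_def by (intro span_base) (auto intro!: exI[of _ "[]"])
qed

lemma uea_grade_mult:
  assumes "x \<in> uea_grade G p" "y \<in> uea_grade G q"
  shows "x * y \<in> uea_grade G (p + q)"
proof -
  let ?M = "\<lambda>p. {uea_prod xs |xs ks. list_all2 (\<lambda>x k. x \<in> G k) xs ks \<and> sum_list ks = p}"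
  have base: "a * b \<in> ?M (p + q)" if "a \<in> ?M p" "b \<in> ?M q" for a b
  proof -
    from that obtain xs ks ys ls where
      "a = uea_prod xs" "list_all2 (\<lambda>x k. x \<in> G k) xs ks" "sum_list ks = p"
      "b = uea_prod ys" "list_all2 (\<lambda>x k. x \<in> G k) ys ls" "sum_list ls = q" by blast
    then have "a * b = uea_prod (xs @ ys) \<and> list_all2 (\<lambda>x k. x \<in> G k) (xs @ ys) (ks @ ls) \<and>
        sum_list (ks @ ls) = p + q"
      by (auto simp: uea_prod_def intro: list_all2_appendI)
    then show ?thesis by blast
  qed
  have left: "a * y \<in> span (?M (p + q))" if a: "a \<in> ?M p" for a
    using assms(2) unfolding uea_grade_def
  proof (induction rule: span_induct_alt)
    case (step c b z)
    then show ?case using span_base[OF base[OF a step(1)]]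
      by (simp only: distrib_left mult_scaleR_right) (intro span_add span_scale)
  qed (simp add: span_zero)
  show ?thesis
    using assms(1) unfolding uea_grade_def
  proof (induction rule: span_induct_alt)
    case (step c b z)
    then show ?case using left[OF step(1)]
      by (simp only: distrib_right mult_scaleR_left) (intro span_add span_scale)
  qed (simp add: span_zero)
qed

lemma unital_subalgebra_uea_series: "unital_subalgebra (uea_series G)"
  unfolding unital_subalgebra_def
proof (intro conjI ballI)
  have sub: "subspace (uea_grade G p)" for p by (simp add: uea_grade_def)
  show "subspace (uea_series G)"
    using sub by (auto simp: uea_series_def subspace_def scaleR_fps_def)
  show "1 \<in> uea_series G"
    using uea_grade_1 subspace_0[OF sub] by (auto simp: uea_series_def)
  fix z u assume z: "z \<in> uea_series G" "u \<in> uea_series G"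
  have "fps_nth z i * fps_nth u (p - i) \<in> uea_grade G p" if "i \<le> p" for i p
    using uea_grade_mult[of "fps_nth z i" G i "fps_nth u (p - i)" "p - i"] z that
    by (simp add: uea_series_def)
  then show "z * u \<in> uea_series G"
    by (auto simp: uea_series_def fps_mult_nth intro!: subspace_sum[OF sub])
qed

section \<open>Norms and the algebra \<open>U\<^sup>!(\<gg>)\<close>\<close>

text \<open>Words of length \<open>p\<close> in \<open>\<omega> 1, \<dots>, \<omega> n\<close>, given by their lists of indices.\<close>

definition index_words :: "nat \<Rightarrow> nat \<Rightarrow> nat list set" where
  "index_words n p = {js. length js = p \<and> set js \<subseteq> {1..n}}"

text \<open>
  There are only finitely many words of length \<open>p\<close>, so a finite linear combination is a choice of a
  coefficient for each of them.  The norm is extended-real-valued so that the infimum is \<open>\<infinity>\<close> if \<open>z\<close>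
  has no representation; this does not happen for \<open>z \<in> U(\<gg>)\<^bsup>[p]\<^esup>\<close>, as \<open>\<gg>\<close> is generated in degree 1.
\<close>

definition word_norm ::
    "nat \<Rightarrow> (nat \<Rightarrow> 'g::lie_algebra) \<Rightarrow> nat \<Rightarrow> 'g uea \<Rightarrow> ereal" where
  "word_norm n \<omega> p z =
     Inf {ereal (\<Sum>w\<in>index_words n p. \<bar>c w\<bar>) |c.
            z = (\<Sum>w\<in>index_words n p. c w *\<^sub>R uea_prod (map \<omega> w))}"

definition series_norm ::
    "nat \<Rightarrow> (nat \<Rightarrow> 'g::lie_algebra) \<Rightarrow> real \<Rightarrow> 'g uea fps \<Rightarrow> ereal" where
  "series_norm n \<omega> a z = (SUP p. word_norm n \<omega> p (fps_nth z p) * ereal (fact p / a ^ p))"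

definition U_fact_at ::
    "(nat \<Rightarrow> 'g::lie_algebra set) \<Rightarrow> nat \<Rightarrow> (nat \<Rightarrow> 'g) \<Rightarrow> real \<Rightarrow> 'g uea fps set" where
  "U_fact_at G n \<omega> a = {z \<in> uea_series G. series_norm n \<omega> a z < \<infinity>}"

definition U_fact ::
    "(nat \<Rightarrow> 'g::lie_algebra set) \<Rightarrow> nat \<Rightarrow> (nat \<Rightarrow> 'g) \<Rightarrow> 'g uea fps set" where
  "U_fact G n \<omega> = (\<Union>a\<in>{0<..}. U_fact_at G n \<omega> a)"

end

(*
  The norm of U(g)^[p] is submultiplicative and at most 1 on words, so the norm of
  (zu)^[p] is at most [[z]]_a [[u]]_b \<Sum>_(i+j=p) a^i/i! b^j/j!, and the binomial theorem
  turns the sum into (a+b)^p/p!.  If every \<omega>'_j has norm at most C with respect to \<omega>,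
  submultiplicativity bounds \<omega>'-words of length p by C^p, so that U^!_a for \<omega>' is contained
  in U^!_(C a) for \<omega>.
*)
theory Submission
  imports Defs
begin

section \<open>Words, and linearity of the embedding of the Lie algebra into its enveloping
  algebra\<close>

lemma finite_index_words: "finite (index_words n p)"
proof -
  have "index_words n p = {js. set js \<subseteq> {1..n} \<and> length js = p}"
    by (auto simp: index_words_def)
  then show ?thesis by (simp add: finite_lists_length_eq)
qed

lemma uea_prod_append: "uea_prod (xs @ ys) = uea_prod xs * uea_prod ys"
  by (simp add: uea_prod_def)

text \<open>The generators \<open>lin_add\<close> and \<open>lin_scale\<close> of
  \<open>uea_ideal\<close> impose exactly linearity of the embedding, which lets one basis be
  expressed in another in degree 1.\<close>

lemma uea_emb_add: "uea_emb (x + y) = uea_emb x + uea_emb y"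
proof (transfer, unfold uea_rel_def)
  fix x y :: 'a
  show "free_gen (x + y) - (free_gen x + free_gen y) \<in> uea_ideal"
    using uea_ideal.lin_add[of x y] by (simp add: algebra_simps)
qed

lemma uea_emb_scaleR: "uea_emb (r *\<^sub>R x) = r *\<^sub>R uea_emb x"
  by transfer (simp add: uea_rel_def uea_ideal.lin_scale)

lemma uea_emb_0: "uea_emb 0 = 0"
  using uea_emb_scaleR[of 0 0] by simp

section \<open>The norm on homogeneous elements\<close>

lemma word_norm_le_sum:
  assumes "z = (\<Sum>w\<in>index_words n p. c w *\<^sub>R uea_prod (map \<omega> w))"
  shows "word_norm n \<omega> p z \<le> ereal (\<Sum>w\<in>index_words n p. \<bar>c w\<bar>)"
  unfolding word_norm_def using assms by (intro Inf_lower) blast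

text \<open>The infimum is not known to be attained, so representations within \<open>e\<close> of
  the bound are taken. A real bound also ensures that a representation exists, since an empty
  infimum is \<infinity>.\<close>

lemma word_norm_approx:
  assumes "word_norm n \<omega> p z \<le> ereal r" "0 < e"
  obtains c where "z = (\<Sum>w\<in>index_words n p. c w *\<^sub>R uea_prod (map \<omega> w))"
    and "(\<Sum>w\<in>index_words n p. \<bar>c w\<bar>) < r + e"
proof -
  have "word_norm n \<omega> p z < ereal (r + e)"
    using assms by (auto intro: le_less_trans)
  then show ?thesis
    unfolding word_norm_def Inf_less_iff using that by auto
qed

lemma word_norm_nonneg: "0 \<le> word_norm n \<omega> p z"
  unfolding word_norm_def by (intro Inf_greatest) (auto intro!: sum_nonneg)

text \<open>Removes the \<open>e\<close> introduced by \<open>word_norm_approx\<close>. The bound is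
  an arbitrary function of \<open>e\<close>, so that sums and products of perturbed bounds are
  treated alike.\<close>

lemma ereal_le_tendsto:
  assumes "\<And>e. 0 < e \<Longrightarrow> x \<le> ereal (f e)" "(f \<longlongrightarrow> r) (at_right (0::real))"
  shows "x \<le> ereal r"
proof (rule tendsto_lowerbound)
  show "((\<lambda>e. ereal (f e)) \<longlongrightarrow> ereal r) (at_right 0)"
    using assms(2) by simp
  show "\<forall>\<^sub>F e in at_right 0. x \<le> ereal (f e)"
    using assms(1) by (auto simp: eventually_at_filter)
qed simp

lemma word_norm_0: "word_norm n \<omega> p 0 = 0"
  using word_norm_le_sum[where c = "\<lambda>_. 0" and z = 0 and n = n and p = p and \<omega> = \<omega>]
    word_norm_nonneg[of n \<omega> p 0]
  by (simp add: zero_ereal_def)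

text \<open>Representations over the common index set add coefficientwise. Hypotheses and conclusion
  are real bounds, so infinite norms never have to be added or multiplied.\<close>

lemma word_norm_add_le:
  assumes "word_norm n \<omega> p x \<le> ereal r" "word_norm n \<omega> p y \<le> ereal s"
  shows "word_norm n \<omega> p (x + y) \<le> ereal (r + s)"
proof (rule ereal_le_tendsto)
  fix e :: real assume "0 < e"
  obtain c where c: "x = (\<Sum>w\<in>index_words n p. c w *\<^sub>R uea_prod (map \<omega> w))"
      "(\<Sum>w\<in>index_words n p. \<bar>c w\<bar>) < r + e"
    using word_norm_approx[OF assms(1) \<open>0 < e\<close>] .
  obtain d where d: "y = (\<Sum>w\<in>index_words n p. d w *\<^sub>R uea_prod (map \<omega> w))"
      "(\<Sum>w\<in>index_words n p. \<bar>d w\<bar>) < s + e"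
    using word_norm_approx[OF assms(2) \<open>0 < e\<close>] .
  have "word_norm n \<omega> p (x + y) \<le> ereal (\<Sum>w\<in>index_words n p. \<bar>c w + d w\<bar>)"
    by (rule word_norm_le_sum) (simp add: c(1) d(1) scaleR_add_left sum.distrib)
  also have "(\<Sum>w\<in>index_words n p. \<bar>c w + d w\<bar>)
      \<le> (\<Sum>w\<in>index_words n p. \<bar>c w\<bar>) + (\<Sum>w\<in>index_words n p. \<bar>d w\<bar>)"
    by (simp flip: sum.distrib add: sum_mono abs_triangle_ineq)
  also have "\<dots> \<le> (r + e) + (s + e)"
    using c(2) d(2) by simp
  finally show "word_norm n \<omega> p (x + y) \<le> ereal ((r + e) + (s + e))" by simp
qed (auto intro!: tendsto_eq_intros)

lemma word_norm_scaleR_le: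
  assumes "word_norm n \<omega> p x \<le> ereal r"
  shows "word_norm n \<omega> p (k *\<^sub>R x) \<le> ereal (\<bar>k\<bar> * r)"
proof (rule ereal_le_tendsto)
  fix e :: real assume "0 < e"
  obtain c where c: "x = (\<Sum>w\<in>index_words n p. c w *\<^sub>R uea_prod (map \<omega> w))"
      "(\<Sum>w\<in>index_words n p. \<bar>c w\<bar>) < r + e"
    using word_norm_approx[OF assms \<open>0 < e\<close>] .
  have "word_norm n \<omega> p (k *\<^sub>R x) \<le> ereal (\<Sum>w\<in>index_words n p. \<bar>k * c w\<bar>)"
    by (rule word_norm_le_sum) (simp add: c(1) scaleR_sum_right)
  also have "(\<Sum>w\<in>index_words n p. \<bar>k * c w\<bar>) = \<bar>k\<bar> * (\<Sum>w\<in>index_words n p. \<bar>c w\<bar>)"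
    by (simp add: abs_mult sum_distrib_left)
  also have "\<dots> \<le> \<bar>k\<bar> * (r + e)"
    using c(2) by (intro mult_left_mono) auto
  finally show "word_norm n \<omega> p (k *\<^sub>R x) \<le> ereal (\<bar>k\<bar> * (r + e))" by simp
qed (auto intro!: tendsto_eq_intros)

lemma word_norm_sum_le:
  assumes "\<And>i. i \<in> I \<Longrightarrow> word_norm n \<omega> p (f i) \<le> ereal (r i)"
  shows "word_norm n \<omega> p (\<Sum>i\<in>I. f i) \<le> ereal (\<Sum>i\<in>I. r i)"
  using assms
  \<comment> \<open>For infinite \<open>I\<close> both sums are 0 by convention.\<close>
  by (induction I rule: infinite_finite_induct)
    (auto simp: word_norm_0 simp del: plus_ereal.simps intro!: word_norm_add_le)

lemma word_norm_word_le:
  assumes "w \<in> index_words n p"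
  shows "word_norm n \<omega> p (uea_prod (map \<omega> w)) \<le> ereal 1"
proof -
  have "uea_prod (map \<omega> w) = (\<Sum>v\<in>index_words n p. of_bool (v = w) *\<^sub>R uea_prod (map \<omega> v))"
    using assms finite_index_words[of n p]
    by (simp add: of_bool_def if_distrib[of "\<lambda>x. x *\<^sub>R _"] cong: if_cong)
  from word_norm_le_sum[OF this] show ?thesis
    using assms finite_index_words[of n p] by (simp flip: of_bool_def)
qed

text \<open>Concatenating words of lengths \<open>p\<close> and \<open>q\<close> gives a word of
  length \<open>p + q\<close>. The double sum is estimated term by term, which avoids reindexing it
  by the concatenated words.\<close>

lemma word_norm_mult_le:
  assumes "word_norm n \<omega> p x \<le> ereal r" "word_norm n \<omega> q y \<le> ereal s"
  shows "word_norm n \<omega> (p + q) (x * y) \<le> ereal (r * s)"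
proof (rule ereal_le_tendsto)
  fix e :: real assume "0 < e"
  obtain c where c: "x = (\<Sum>w\<in>index_words n p. c w *\<^sub>R uea_prod (map \<omega> w))"
      "(\<Sum>w\<in>index_words n p. \<bar>c w\<bar>) < r + e"
    using word_norm_approx[OF assms(1) \<open>0 < e\<close>] .
  obtain d where d: "y = (\<Sum>w\<in>index_words n q. d w *\<^sub>R uea_prod (map \<omega> w))"
      "(\<Sum>w\<in>index_words n q. \<bar>d w\<bar>) < s + e"
    using word_norm_approx[OF assms(2) \<open>0 < e\<close>] .
  have word: "word_norm n \<omega> (p + q) (uea_prod (map \<omega> (v @ w))) \<le> ereal 1"
    if "v \<in> index_words n p" "w \<in> index_words n q" for v w
    using that by (intro word_norm_word_le) (auto simp: index_words_def)
  have "x * y = (\<Sum>v\<in>index_words n p. \<Sum>w\<in>index_words n q.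
      (c v * d w) *\<^sub>R uea_prod (map \<omega> (v @ w)))"
    by (simp add: c(1) d(1) sum_product uea_prod_append mult.commute)
  also have "word_norm n \<omega> (p + q) \<dots>
      \<le> ereal (\<Sum>v\<in>index_words n p. \<Sum>w\<in>index_words n q. \<bar>c v * d w\<bar> * 1)"
    by (intro word_norm_sum_le word_norm_scaleR_le word)
  also have "(\<Sum>v\<in>index_words n p. \<Sum>w\<in>index_words n q. \<bar>c v * d w\<bar> * 1)
      = (\<Sum>v\<in>index_words n p. \<bar>c v\<bar>) * (\<Sum>w\<in>index_words n q. \<bar>d w\<bar>)"
    by (simp add: abs_mult sum_product)
  also have "\<dots> \<le> (r + e) * (s + e)"
    using c(2) d(2) by (smt (verit) abs_ge_zero mult_mono sum_nonneg)
  finally show "word_norm n \<omega> (p + q) (x * y) \<le> ereal ((r + e) * (s + e))" by simp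
qed (auto intro!: tendsto_eq_intros)

section \<open>The norms on formal series\<close>

text \<open>Clears the weight in the supremum, leaving one real bound per degree, to which the
  estimates for homogeneous elements apply.\<close>

lemma series_norm_le_iff:
  assumes "0 < a"
  shows "series_norm n \<omega> a z \<le> ereal K \<longleftrightarrow>
    (\<forall>p. word_norm n \<omega> p (fps_nth z p) \<le> ereal (K * (a ^ p / fact p)))"
proof -
  have "N * ereal (fact p / a ^ p) \<le> ereal K \<longleftrightarrow> N \<le> ereal (K * (a ^ p / fact p))"
    if "0 \<le> N" for N p
    \<comment> \<open>If \<open>N\<close> is \<infinity>, both sides fail, because the weight
      \<open>fact p / a ^ p\<close> is positive.\<close>
    using assms that by (cases N) (auto simp: field_simps)
  then show ?thesis
    by (simp add: series_norm_def SUP_le_iff word_norm_nonneg)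
qed

lemma series_norm_nonneg:
  assumes "0 < a"
  shows "0 \<le> series_norm n \<omega> a z"
  unfolding series_norm_def using assms
  by (intro SUP_upper2[of 0]) (auto intro!: word_norm_nonneg ereal_0_le_mult)

lemma U_fact_at_iff:
  assumes "0 < a"
  shows "z \<in> U_fact_at G n \<omega> a \<longleftrightarrow>
    z \<in> uea_series G \<and> (\<exists>K. series_norm n \<omega> a z \<le> ereal K)"
  using series_norm_nonneg[OF assms, of n \<omega> z]
  by (cases "series_norm n \<omega> a z") (auto simp: U_fact_at_def)

lemma series_norm_mult_le:
  assumes "0 < a" "0 < b" "series_norm n \<omega> a z \<le> ereal K" "series_norm n \<omega> b u \<le> ereal L"
  shows "series_norm n \<omega> (a + b) (z * u) \<le> ereal (K * L)"
proof -
  have "word_norm n \<omega> p (fps_nth (z * u) p) \<le> ereal (K * L * ((a + b) ^ p / fact p))" for p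
  proof -
    have "word_norm n \<omega> p (fps_nth (z * u) p)
        \<le> ereal (\<Sum>i\<le>p. (K * (a ^ i / fact i)) * (L * (b ^ (p - i) / fact (p - i))))"
      unfolding fps_mult_nth atLeast0AtMost
    proof (rule word_norm_sum_le)
      fix i assume "i \<in> {..p}"
      then show "word_norm n \<omega> p (fps_nth z i * fps_nth u (p - i))
          \<le> ereal ((K * (a ^ i / fact i)) * (L * (b ^ (p - i) / fact (p - i))))"
        using word_norm_mult_le[of n \<omega> i "fps_nth z i" "K * (a ^ i / fact i)" "p - i"
            "fps_nth u (p - i)" "L * (b ^ (p - i) / fact (p - i))"] assms
        by (simp add: series_norm_le_iff)
    qed
    \<comment> \<open>Since \<open>1 / (fact i * fact (p - i))\<close> is the binomial coefficient
      divided by \<open>fact p\<close>, the convolution is the binomial expansion of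
      \<open>(a + b) ^ p / fact p\<close>.\<close>
    also have "(\<Sum>i\<le>p. (K * (a ^ i / fact i)) * (L * (b ^ (p - i) / fact (p - i))))
        = K * L * ((a + b) ^ p / fact p)"
      unfolding binomial_ring sum_divide_distrib sum_distrib_left
      by (intro sum.cong refl) (simp add: binomial_fact)
    finally show ?thesis .
  qed
  then show ?thesis using assms by (simp add: series_norm_le_iff)
qed

lemma U_fact_at_mult:
  assumes "0 < a" "0 < b" "z \<in> U_fact_at G n \<omega> a" "u \<in> U_fact_at G n \<omega> b"
  shows "z * u \<in> U_fact_at G n \<omega> (a + b)"
    and "series_norm n \<omega> (a + b) (z * u) \<le> series_norm n \<omega> a z * series_norm n \<omega> b u"
proof -
  \<comment> \<open>Membership bounds the norms above and nonnegativity below. Both are therefore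
    real and serve themselves as the bounds \<open>K\<close> and \<open>L\<close>.\<close>
  have "\<bar>series_norm n \<omega> a z\<bar> \<noteq> \<infinity>" "\<bar>series_norm n \<omega> b u\<bar> \<noteq> \<infinity>"
    using assms series_norm_nonneg[of a n \<omega> z] series_norm_nonneg[of b n \<omega> u]
    by (auto simp: U_fact_at_def)
  then obtain K L where KL: "series_norm n \<omega> a z = ereal K" "series_norm n \<omega> b u = ereal L"
    by (auto elim!: ereal_cases)
  have "series_norm n \<omega> (a + b) (z * u) \<le> ereal (K * L)"
    using assms KL by (intro series_norm_mult_le) auto
  moreover have "z * u \<in> uea_series G"
    using assms unital_subalgebra_uea_series[of G] by (simp add: unital_subalgebra_def U_fact_at_def)
  ultimately show "z * u \<in> U_fact_at G n \<omega> (a + b)"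
    and "series_norm n \<omega> (a + b) (z * u) \<le> series_norm n \<omega> a z * series_norm n \<omega> b u"
    using assms by (auto simp: U_fact_at_iff KL)
qed

section \<open>Closure properties of the levels \<open>U_fact_at\<close> and of their union\<close>

lemma U_fact_at_mono:
  assumes "0 < a" "a \<le> b"
  shows "U_fact_at G n \<omega> a \<subseteq> U_fact_at G n \<omega> b"
proof -
  \<comment> \<open>The weight \<open>fact p / a ^ p\<close> decreases as \<open>a\<close>
    grows.\<close>
  have "series_norm n \<omega> b z \<le> series_norm n \<omega> a z" for z
    unfolding series_norm_def using assms
    by (intro SUP_mono' ereal_mult_left_mono word_norm_nonneg)
      (simp add: frac_le power_mono)
  then show ?thesis unfolding U_fact_at_def by (blast intro: le_less_trans)
qed

lemma subspace_U_fact_at: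
  assumes "0 < a"
  shows "subspace (U_fact_at G n \<omega> a)"
proof -
  have series: "subspace (uea_series G)"
    using unital_subalgebra_uea_series[of G] by (simp add: unital_subalgebra_def)
  show ?thesis
  proof (rule subspaceI)
    have "series_norm n \<omega> a 0 \<le> ereal 0"
      using assms by (simp add: series_norm_le_iff word_norm_0)
    then show "0 \<in> U_fact_at G n \<omega> a"
      using assms subspace_0[OF series] by (auto simp: U_fact_at_iff)
  next
    fix z u assume zu: "z \<in> U_fact_at G n \<omega> a" "u \<in> U_fact_at G n \<omega> a"
    then obtain K L where "series_norm n \<omega> a z \<le> ereal K" "series_norm n \<omega> a u \<le> ereal L"
      using assms by (auto simp: U_fact_at_iff)
    then have "series_norm n \<omega> a (z + u) \<le> ereal (K + L)"
      unfolding series_norm_le_iff[OF assms] distrib_right fps_add_nth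
      by (blast intro: word_norm_add_le)
    then show "z + u \<in> U_fact_at G n \<omega> a"
      using assms zu subspace_add[OF series] by (auto simp: U_fact_at_iff simp del: plus_ereal.simps)
  next
    fix k :: real and z assume z: "z \<in> U_fact_at G n \<omega> a"
    then obtain K where "series_norm n \<omega> a z \<le> ereal K"
      using assms by (auto simp: U_fact_at_iff)
    then have "series_norm n \<omega> a (k *\<^sub>R z) \<le> ereal (\<bar>k\<bar> * K)"
      unfolding series_norm_le_iff[OF assms] scaleR_fps_def fps_nth_Abs_fps mult.assoc
      by (blast intro: word_norm_scaleR_le)
    then show "k *\<^sub>R z \<in> U_fact_at G n \<omega> a"
      using assms z subspace_scale[OF series] by (auto simp: U_fact_at_iff)
  qed
qed

text \<open>The unit is the empty word: it lives in degree 0, where the weight is 1 for every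
  \<open>a\<close>.\<close>

lemma one_mem_U_fact_at:
  assumes "0 < a"
  shows "1 \<in> U_fact_at G n \<omega> a"
proof -
  have "word_norm n \<omega> 0 1 \<le> ereal 1"
    using word_norm_word_le[of "[]" n 0 \<omega>] by (simp add: index_words_def uea_prod_def)
  then have "series_norm n \<omega> a 1 \<le> ereal 1"
    using assms by (auto simp: series_norm_le_iff word_norm_0)
  moreover have "1 \<in> uea_series G"
    using unital_subalgebra_uea_series[of G] by (simp add: unital_subalgebra_def)
  ultimately show ?thesis using assms by (auto simp: U_fact_at_iff)
qed

text \<open>Sums are formed at the common level \<open>max a b\<close>, and products land at level
  \<open>a + b\<close>; the union over all levels absorbs both changes.\<close>

lemma unital_subalgebra_U_fact: "unital_subalgebra (U_fact G n \<omega>)"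
proof -
  have add: "z + u \<in> U_fact G n \<omega>" if zu: "z \<in> U_fact G n \<omega>" "u \<in> U_fact G n \<omega>" for z u
  proof -
    from zu obtain a b where ab: "0 < a" "0 < b" "z \<in> U_fact_at G n \<omega> a" "u \<in> U_fact_at G n \<omega> b"
      by (auto simp: U_fact_def)
    then have "z \<in> U_fact_at G n \<omega> (max a b)" "u \<in> U_fact_at G n \<omega> (max a b)"
      using U_fact_at_mono[of a "max a b" G n \<omega>] U_fact_at_mono[of b "max a b" G n \<omega>] by auto
    then have "z + u \<in> U_fact_at G n \<omega> (max a b)"
      using ab by (intro subspace_add subspace_U_fact_at) auto
    then show ?thesis
      using ab by (auto simp: U_fact_def intro!: bexI[of _ "max a b"])
  qed
  have mult: "z * u \<in> U_fact G n \<omega>" if zu: "z \<in> U_fact G n \<omega>" "u \<in> U_fact G n \<omega>" for z u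
  proof -
    from zu obtain a b where "0 < a" "0 < b" "z \<in> U_fact_at G n \<omega> a" "u \<in> U_fact_at G n \<omega> b"
      by (auto simp: U_fact_def)
    then show ?thesis
      using U_fact_at_mult(1)[of a b z G n \<omega> u] by (auto simp: U_fact_def intro!: bexI[of _ "a + b"])
  qed
  \<comment> \<open>The elements 1 and 0 lie in every level; level 1 is an arbitrary choice.\<close>
  have one: "1 \<in> U_fact G n \<omega>"
    using one_mem_U_fact_at[of 1] by (auto simp: U_fact_def intro!: bexI[of _ 1])
  have zero: "0 \<in> U_fact G n \<omega>"
    using subspace_0[OF subspace_U_fact_at[of 1]] by (auto simp: U_fact_def intro!: bexI[of _ 1])
  have scale: "k *\<^sub>R z \<in> U_fact G n \<omega>" if "z \<in> U_fact G n \<omega>" for k z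
    using that by (auto simp: U_fact_def intro!: subspace_scale subspace_U_fact_at)
  show ?thesis
    unfolding unital_subalgebra_def using add mult one zero scale by (blast intro: subspaceI)
qed

section \<open>Change of basis\<close>

text \<open>By linearity of the embedding, \<open>x\<close> becomes a finite combination of
  one-letter words, each of norm at most 1.\<close>

lemma word_norm_emb_finite:
  assumes "x \<in> span (\<omega> ` {1..n})"
  shows "\<exists>r. word_norm n \<omega> 1 (uea_emb x) \<le> ereal r"
  using assms
proof (induction rule: span_induct_alt)
  case base
  then show ?case by (auto simp: uea_emb_0 word_norm_0 intro!: exI[of _ 0])
next
  case (step k y x)
  then obtain j where j: "j \<in> {1..n}" "y = \<omega> j" by blast
  from step obtain r where r: "word_norm n \<omega> 1 (uea_emb x) \<le> ereal r" by blast
  have "word_norm n \<omega> 1 (uea_emb y) \<le> ereal 1"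
    using j word_norm_word_le[of "[j]" n 1 \<omega>]
    by (simp add: index_words_def uea_prod_def)
  from word_norm_add_le[OF word_norm_scaleR_le[OF this] r] show ?case
    unfolding uea_emb_add uea_emb_scaleR by blast
qed

lemma word_norm_word_le_power:
  assumes "\<And>j. j \<in> {1..m} \<Longrightarrow> word_norm n \<omega> 1 (uea_emb (\<omega>' j)) \<le> ereal C"
    and "w \<in> index_words m p"
  shows "word_norm n \<omega> p (uea_prod (map \<omega>' w)) \<le> ereal (C ^ p)"
  using assms(2)
proof (induction p arbitrary: w)
  case 0
  then show ?case
    using word_norm_word_le[of "[]" n 0 \<omega>] by (simp add: index_words_def uea_prod_def)
next
  case (Suc p)
  then obtain j v where w: "w = j # v" "j \<in> {1..m}" "v \<in> index_words m p"
    by (auto simp: index_words_def length_Suc_conv)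
  \<comment> \<open>Splitting off the first letter contributes one factor \<open>C\<close>, and the
    degrees add up as \<open>1 + p = Suc p\<close>.\<close>
  then show ?case
    using word_norm_mult_le[OF assms(1)[OF w(2)] Suc.IH[OF w(3)]]
    by (simp add: uea_prod_def)
qed

text \<open>A one-sided inclusion of spans suffices for one inclusion of algebras, so change of
  basis follows by applying this in both directions.\<close>

lemma U_fact_subset:
  assumes "span (\<omega>' ` {1..m}) \<subseteq> span (\<omega> ` {1..n})"
  shows "U_fact G m \<omega>' \<subseteq> U_fact G n \<omega>"
proof
  fix z assume "z \<in> U_fact G m \<omega>'"
  then obtain a K where a: "0 < a" and z: "z \<in> uea_series G" "series_norm m \<omega>' a z \<le> ereal K"
    by (auto simp: U_fact_def U_fact_at_iff)
  have "\<forall>j\<in>{1..m}. \<exists>r. word_norm n \<omega> 1 (uea_emb (\<omega>' j)) \<le> ereal r"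
    using assms by (intro ballI word_norm_emb_finite) (blast intro: span_base)
  then obtain r where r: "\<And>j. j \<in> {1..m} \<Longrightarrow> word_norm n \<omega> 1 (uea_emb (\<omega>' j)) \<le> ereal (r j)"
    by metis
  \<comment> \<open>A common bound for all the \<open>r j\<close>. The summand 1 keeps
    \<open>C\<close> positive even for \<open>m = 0\<close>, so that \<open>a * C\<close> is an
    admissible level.\<close>
  define C where "C = 1 + (\<Sum>j\<in>{1..m}. \<bar>r j\<bar>)"
  have "0 < C"
    unfolding C_def by (simp add: add_pos_nonneg sum_nonneg)
  have "r j \<le> C" if "j \<in> {1..m}" for j
    using member_le_sum[OF that, of "\<lambda>j. \<bar>r j\<bar>"] by (simp add: C_def)
  with r have C: "word_norm n \<omega> 1 (uea_emb (\<omega>' j)) \<le> ereal C" if "j \<in> {1..m}" for j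
    using that by (meson ereal_less_eq(3) order_trans)
  have "word_norm n \<omega> p (fps_nth z p) \<le> ereal (K * ((a * C) ^ p / fact p))" for p
  proof (rule ereal_le_tendsto)
    fix e :: real assume "0 < e"
    have "word_norm m \<omega>' p (fps_nth z p) \<le> ereal (K * (a ^ p / fact p))"
      using z a by (simp add: series_norm_le_iff)
    then obtain c where c: "fps_nth z p = (\<Sum>w\<in>index_words m p. c w *\<^sub>R uea_prod (map \<omega>' w))"
        "(\<Sum>w\<in>index_words m p. \<bar>c w\<bar>) < K * (a ^ p / fact p) + e"
      using \<open>0 < e\<close> by (rule word_norm_approx)
    \<comment> \<open>Each word in the letters \<open>\<omega>'\<close> costs at most
      \<open>C ^ p\<close> in terms of \<open>\<omega>\<close>. As \<open>e\<close> tends to 0, this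
      power merges with \<open>a ^ p\<close> into \<open>(a * C) ^ p\<close>: the level changes,
      while the bound \<open>K\<close> is kept.\<close>
    have "word_norm n \<omega> p (fps_nth z p) \<le> ereal (\<Sum>w\<in>index_words m p. \<bar>c w\<bar> * C ^ p)"
      unfolding c(1) by (intro word_norm_sum_le word_norm_scaleR_le word_norm_word_le_power C)
    also have "(\<Sum>w\<in>index_words m p. \<bar>c w\<bar> * C ^ p) \<le> (K * (a ^ p / fact p) + e) * C ^ p"
      unfolding sum_distrib_right[symmetric] using c(2) \<open>0 < C\<close> by (intro mult_right_mono) auto
    finally show "word_norm n \<omega> p (fps_nth z p) \<le> ereal ((K * (a ^ p / fact p) + e) * C ^ p)"
      by simp
  qed (auto intro!: tendsto_eq_intros simp: power_mult_distrib)
  then have "series_norm n \<omega> (a * C) z \<le> ereal K"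
    using a \<open>0 < C\<close> by (simp add: series_norm_le_iff)
  then have "z \<in> U_fact_at G n \<omega> (a * C)"
    using a \<open>0 < C\<close> z by (auto simp: U_fact_at_iff)
  then show "z \<in> U_fact G n \<omega>"
    using a \<open>0 < C\<close> by (auto simp: U_fact_def intro!: bexI[of _ "a * C"])
qed

theorem proposition5p1:
  fixes G :: "nat \<Rightarrow> 'g::lie_algebra set" and n :: nat and \<omega> :: "nat \<Rightarrow> 'g"
  assumes "graded_lie_algebra G"
    and "is_basis n \<omega> (G 1)"
  shows "unital_subalgebra (U_fact G n \<omega>)
    \<and> (\<forall>(a::real) (b::real) z u. 0 < a \<longrightarrow> 0 < b \<longrightarrow>
          z \<in> U_fact_at G n \<omega> a \<longrightarrow> u \<in> U_fact_at G n \<omega> b \<longrightarrow>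
          z * u \<in> U_fact_at G n \<omega> (a + b) \<and>
          series_norm n \<omega> (a + b) (z * u) \<le> series_norm n \<omega> a z * series_norm n \<omega> b u)
    \<and> (\<forall>(m::nat) (\<omega>'::nat \<Rightarrow> 'g). is_basis m \<omega>' (G 1) \<longrightarrow> U_fact G m \<omega>' = U_fact G n \<omega>)"
proof (intro conjI allI impI)
  show "unital_subalgebra (U_fact G n \<omega>)"
    by (rule unital_subalgebra_U_fact)
next
  fix m :: nat and \<omega>' :: "nat \<Rightarrow> 'g"
  assume "is_basis m \<omega>' (G 1)"
  \<comment> \<open>Both spans are \<open>G 1\<close>.\<close>
  then have "span (\<omega>' ` {1..m}) = span (\<omega> ` {1..n})"
    using assms(2) by (simp add: is_basis_def)
  then show "U_fact G m \<omega>' = U_fact G n \<omega>"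
    using U_fact_subset[of \<omega>' m \<omega> n G] U_fact_subset[of \<omega> n \<omega>' m G] by simp
qed (fact U_fact_at_mult)+

end
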